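(* Let $m\geq 3$ be an odd integer. If $t\geq 1$ is an integer, then $\mathcal{E}_c^-(D_{2^{t+1}m})$ and $\mathcal{E}_c^-(Q_{2^{t+1}m})$ are isomorphic to $K_{m\cdot 2^t}$. Further, $\mathcal{E}_c^-(D_{2m})$ is isomorphic to $K_m$.
   Context: For elements $x,y$ of a group, $[x,y]=x^{-1}y^{-1}xy$, $[x,{}_1y]=[x,y]$ and $[x,{}_{k+1}y]=[[x,{}_ky],y]$ for $k\ge 1$. For a finite group $G$ with Fitting subgroup $F(G)$, $\mathcal{E}_c^-(G)$ is the simple undirected graph with vertex set $G\setminus F(G)$ in which distinct $x,y$ are adjacent iff $[x,{}_ky]\neq 1$ and $[y,{}_kx]\neq 1$ for all positive integers $k$. $D_{2n}=\langle x,y\mid y^n=x^2=1,\ xyx^{-1}=y^{-1}\rangle$ is the dihedral group of order $2n$. $Q_{2^{t+1}m}=\langle x,y\mid y^{2^tm}=1,\ x^2=y^{2^{t-1}m},\ xyx^{-1}=y^{-1}\rangle$ (a group of order $2^{t+1}m$). $K_m$ is the complete graph on $m$ vertices and $K_{a\cdot b}$ is the complete $a$-partite graph in which each of the $a$ parts has size $b$. *)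

theory Defs
  imports
    "HOL-Algebra.Coset"
    "HOL-Algebra.Generated_Groups"
    "Graph_Theory.Digraph_Isomorphism"
    "Graph_Theory.Pair_Digraph"
    "Graph_Theory.Kuratowski"
begin

section \<open>Groups given by generators and relations\<close>

text \<open>A word is a list of letters; \<open>(a, True)\<close> stands for the generator \<open>a\<close> and
  \<open>(a, False)\<close> for its formal inverse. A pair \<open>(r, s)\<close> of words in \<open>R\<close> is the
  relation \<open>r = s\<close>. The presented group consists of the words modulo the congruence
  generated by free cancellation and \<open>R\<close>.\<close>

type_synonym 'a word = "('a \<times> bool) list"

inductive_set pres_rel :: "('a word \<times> 'a word) set \<Rightarrow> ('a word \<times> 'a word) set"
  for R :: "('a word \<times> 'a word) set" where
  refl: "(u, u) \<in> pres_rel R"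
| sym: "(u, v) \<in> pres_rel R \<Longrightarrow> (v, u) \<in> pres_rel R"
| trans: "(u, v) \<in> pres_rel R \<Longrightarrow> (v, w) \<in> pres_rel R \<Longrightarrow> (u, w) \<in> pres_rel R"
| cancel: "(u @ [(a, b), (a, \<not> b)] @ v, u @ v) \<in> pres_rel R"
| rel: "(r, s) \<in> R \<Longrightarrow> (u @ r @ v, u @ s @ v) \<in> pres_rel R"

definition presented_group :: "('a word \<times> 'a word) set \<Rightarrow> 'a word set monoid" where
  "presented_group R =
    \<lparr>carrier = UNIV // pres_rel R,
     monoid.mult = (\<lambda>A B. \<Union>u\<in>A. \<Union>v\<in>B. pres_rel R `` {u @ v}),
     one = pres_rel R `` {[]}\<rparr>"

lemma equiv_pres_rel: "equiv UNIV (pres_rel R)"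
  by (intro equivI refl_onI symI transI) (auto intro: pres_rel.intros)

lemma pres_rel_context:
  assumes "(u, v) \<in> pres_rel R"
  shows "(p @ u @ q, p @ v @ q) \<in> pres_rel R"
  using assms
proof induction
  case (cancel u a b v)
  show ?case using pres_rel.cancel[of "p @ u" a b "v @ q" R] by simp
next
  case (rel r s u v)
  then show ?case using pres_rel.rel[of r s R "p @ u" "v @ q"] by simp
qed (blast intro: pres_rel.intros)+

lemma pres_rel_append:
  assumes "(u, u') \<in> pres_rel R" "(v, v') \<in> pres_rel R"
  shows "(u @ v, u' @ v') \<in> pres_rel R"
  using pres_rel_context[OF assms(1), of "[]" v] pres_rel_context[OF assms(2), of u' "[]"]
  by (auto intro: pres_rel.trans)

lemma presented_group_mult:
  "pres_rel R `` {u} \<otimes>\<^bsub>presented_group R\<^esub> pres_rel R `` {v} = pres_rel R `` {u @ v}"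
proof -
  have eq: "pres_rel R `` {u' @ v'} = pres_rel R `` {u @ v}"
    if "(u, u') \<in> pres_rel R" "(v, v') \<in> pres_rel R" for u' v'
    using equiv_class_eq[OF equiv_pres_rel pres_rel_append[OF that]] by simp
  have "(\<Union>u'\<in>pres_rel R `` {u}. \<Union>v'\<in>pres_rel R `` {v}. pres_rel R `` {u' @ v'})
      = (\<Union>u'\<in>pres_rel R `` {u}. \<Union>v'\<in>pres_rel R `` {v}. pres_rel R `` {u @ v})"
    by (intro SUP_cong HOL.refl eq) (simp_all only: Image_singleton_iff)
  also have "\<dots> = pres_rel R `` {u @ v}"
    using pres_rel.refl[of u R] pres_rel.refl[of v R] by blast
  finally show ?thesis by (simp add: presented_group_def)
qed

lemma pres_rel_inverse_word:
  "(map (\<lambda>(a, b). (a, \<not> b)) (rev u) @ u, []) \<in> pres_rel R"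
proof (induction u)
  case Nil
  show ?case by (simp add: pres_rel.refl)
next
  case (Cons x u)
  obtain a b where x: "x = (a, b)" by fastforce
  show ?case
    using pres_rel.trans[OF pres_rel.cancel[of "map (\<lambda>(a, b). (a, \<not> b)) (rev u)" a "\<not> b" u R]]
      Cons.IH by (simp add: x)
qed

lemma group_presented_group: "group (presented_group R)"
proof (rule groupI)
  fix x y assume "x \<in> carrier (presented_group R)" "y \<in> carrier (presented_group R)"
  then obtain u v where "x = pres_rel R `` {u}" "y = pres_rel R `` {v}"
    by (auto simp: presented_group_def elim!: quotientE)
  then show "x \<otimes>\<^bsub>presented_group R\<^esub> y \<in> carrier (presented_group R)"
    by (simp add: presented_group_mult) (simp add: presented_group_def quotientI)
next
  show "\<one>\<^bsub>presented_group R\<^esub> \<in> carrier (presented_group R)"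
    by (simp add: presented_group_def quotientI)
next
  fix x y z
  assume "x \<in> carrier (presented_group R)" "y \<in> carrier (presented_group R)"
    "z \<in> carrier (presented_group R)"
  then obtain u v w where "x = pres_rel R `` {u}" "y = pres_rel R `` {v}" "z = pres_rel R `` {w}"
    by (auto simp: presented_group_def elim!: quotientE)
  then show "x \<otimes>\<^bsub>presented_group R\<^esub> y \<otimes>\<^bsub>presented_group R\<^esub> z
      = x \<otimes>\<^bsub>presented_group R\<^esub> (y \<otimes>\<^bsub>presented_group R\<^esub> z)"
    by (simp add: presented_group_mult)
next
  have one: "\<one>\<^bsub>presented_group R\<^esub> = pres_rel R `` {[]}" by (simp add: presented_group_def)
  fix x assume "x \<in> carrier (presented_group R)"
  then obtain u where x: "x = pres_rel R `` {u}"
    by (auto simp: presented_group_def elim!: quotientE)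
  show "\<one>\<^bsub>presented_group R\<^esub> \<otimes>\<^bsub>presented_group R\<^esub> x = x"
    by (simp add: one x presented_group_mult)
  show "\<exists>y\<in>carrier (presented_group R). y \<otimes>\<^bsub>presented_group R\<^esub> x = \<one>\<^bsub>presented_group R\<^esub>"
  proof
    let ?y = "pres_rel R `` {map (\<lambda>(a, b). (a, \<not> b)) (rev u)}"
    show "?y \<in> carrier (presented_group R)" by (simp add: presented_group_def quotientI)
    show "?y \<otimes>\<^bsub>presented_group R\<^esub> x = \<one>\<^bsub>presented_group R\<^esub>"
      using equiv_class_eq[OF equiv_pres_rel pres_rel_inverse_word]
      by (simp add: one x presented_group_mult)
  qed
qed

datatype gen = gen_x | gen_y

text \<open>The argument \<open>n\<close> is half the order: \<open>dihedral_group n\<close> is $D_{2n}$.\<close>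

definition dihedral_group :: "nat \<Rightarrow> gen word set monoid" where
  "dihedral_group n = presented_group
    {(replicate n (gen_y, True), []),
     (replicate 2 (gen_x, True), []),
     ([(gen_x, True), (gen_y, True), (gen_x, False)], [(gen_y, False)])}"

text \<open>\<open>quaternion_group t m\<close> is $Q_{2^{t+1}m}$, meaningful for \<open>t \<ge> 1\<close> only because of the
  exponent \<open>t - 1\<close>.\<close>

definition quaternion_group :: "nat \<Rightarrow> nat \<Rightarrow> gen word set monoid" where
  "quaternion_group t m = presented_group
    {(replicate (2 ^ t * m) (gen_y, True), []),
     (replicate 2 (gen_x, True), replicate (2 ^ (t - 1) * m) (gen_y, True)),
     ([(gen_x, True), (gen_y, True), (gen_x, False)], [(gen_y, False)])}"

section \<open>Commutators and the Fitting subgroup\<close>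

definition commutator :: "('a, 'b) monoid_scheme \<Rightarrow> 'a \<Rightarrow> 'a \<Rightarrow> 'a" where
  "commutator G x y = inv\<^bsub>G\<^esub> x \<otimes>\<^bsub>G\<^esub> inv\<^bsub>G\<^esub> y \<otimes>\<^bsub>G\<^esub> x \<otimes>\<^bsub>G\<^esub> y"

text \<open>\<open>engel_commutator G k x y\<close> is $[x,{}_k y]$; the recursion is started at
  $[x,{}_0 y] = x$, which gives $[x,{}_1 y] = [x,y]$.\<close>

primrec engel_commutator :: "('a, 'b) monoid_scheme \<Rightarrow> nat \<Rightarrow> 'a \<Rightarrow> 'a \<Rightarrow> 'a" where
  "engel_commutator G 0 x y = x"
| "engel_commutator G (Suc k) x y = commutator G (engel_commutator G k x y) y"

primrec lower_central :: "('a, 'b) monoid_scheme \<Rightarrow> nat \<Rightarrow> 'a set" where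
  "lower_central G 0 = carrier G"
| "lower_central G (Suc k) =
    generate G {commutator G x y | x y. x \<in> lower_central G k \<and> y \<in> carrier G}"

definition nilpotent_group :: "('a, 'b) monoid_scheme \<Rightarrow> bool" where
  "nilpotent_group G \<longleftrightarrow> group G \<and> (\<exists>k. lower_central G k = {\<one>\<^bsub>G\<^esub>})"

text \<open>The subgroup generated by all nilpotent normal subgroups. For finite groups it is itself
  nilpotent by Fitting's theorem, hence the largest nilpotent normal subgroup.\<close>

definition fitting_subgroup :: "('a, 'b) monoid_scheme \<Rightarrow> 'a set" where
  "fitting_subgroup G = generate G (\<Union>{N. N \<lhd> G \<and> nilpotent_group (G\<lparr>carrier := N\<rparr>)})"

section \<open>Graphs\<close>

text \<open>As in the Graph Theory library, an undirected graph is a symmetric digraph.\<close>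

definition engel_graph :: "('a, 'b) monoid_scheme \<Rightarrow> 'a pair_pre_digraph" where
  "engel_graph G =
    \<lparr>pverts = carrier G - fitting_subgroup G,
     parcs = {(x, y). x \<in> carrier G - fitting_subgroup G \<and> y \<in> carrier G - fitting_subgroup G \<and>
       x \<noteq> y \<and>
       (\<forall>k\<ge>1. engel_commutator G k x y \<noteq> \<one>\<^bsub>G\<^esub> \<and> engel_commutator G k y x \<noteq> \<one>\<^bsub>G\<^esub>)}\<rparr>"

definition complete_graph :: "nat \<Rightarrow> nat pair_pre_digraph" where
  "complete_graph n = \<lparr>pverts = {..<n}, parcs = {(u, v). u < n \<and> v < n \<and> u \<noteq> v}\<rparr>"

lemma complete_digraph_complete_graph: "complete_digraph n (with_proj (complete_graph n))"
  unfolding complete_digraph_pair_def by (auto simp: complete_graph_def)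

text \<open>\<open>complete_multipartite_graph a b\<close> is $K_{a \cdot b}$: the \<open>a\<close> parts are the sets
  \<open>{i} \<times> {..<b}\<close>.\<close>

definition complete_multipartite_graph :: "nat \<Rightarrow> nat \<Rightarrow> (nat \<times> nat) pair_pre_digraph" where
  "complete_multipartite_graph a b =
    \<lparr>pverts = {..<a} \<times> {..<b},
     parcs = {(u, v). u \<in> {..<a} \<times> {..<b} \<and> v \<in> {..<a} \<times> {..<b} \<and> fst u \<noteq> fst v}\<rparr>"

definition graph_iso :: "'a pair_pre_digraph \<Rightarrow> 'b pair_pre_digraph \<Rightarrow> bool" where
  "graph_iso G H \<longleftrightarrow> digraph_iso (with_proj G) (with_proj H)"

lemma graph_iso_iff:
  assumes "parcs G \<subseteq> pverts G \<times> pverts G" and "parcs H \<subseteq> pverts H \<times> pverts H"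
  shows "graph_iso G H \<longleftrightarrow> (\<exists>f. bij_betw f (pverts G) (pverts H) \<and>
    (\<forall>x\<in>pverts G. \<forall>y\<in>pverts G. (x, y) \<in> parcs G \<longleftrightarrow> (f x, f y) \<in> parcs H))"
proof
  assume "graph_iso G H"
  then obtain h where h: "pre_digraph.digraph_isomorphism (with_proj G) h"
    and H: "with_proj H = app_iso h (with_proj G)"
    unfolding graph_iso_def digraph_iso_def by blast
  have V: "pverts H = iso_verts h ` pverts G" and A: "parcs H = iso_arcs h ` parcs G"
    and "iso_tail h = fst" and "iso_head h = snd"
    using H by (simp_all add: with_proj_def app_iso_def)
  with h have inj: "inj_on (iso_verts h) (pverts G)"
    and arc: "\<And>a. a \<in> parcs G \<Longrightarrow> iso_arcs h a = (iso_verts h (fst a), iso_verts h (snd a))"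
    by (auto simp: pre_digraph.digraph_isomorphism_def prod_eq_iff)
  have "(x, y) \<in> parcs G \<longleftrightarrow> (iso_verts h x, iso_verts h y) \<in> parcs H"
    if xy: "x \<in> pverts G" "y \<in> pverts G" for x y
  proof
    assume "(x, y) \<in> parcs G"
    then show "(iso_verts h x, iso_verts h y) \<in> parcs H"
      using arc[of "(x, y)"] by (force simp: A)
  next
    assume "(iso_verts h x, iso_verts h y) \<in> parcs H"
    then obtain a where a: "a \<in> parcs G" "iso_arcs h a = (iso_verts h x, iso_verts h y)"
      by (auto simp: A)
    then have "iso_verts h (fst a) = iso_verts h x" "iso_verts h (snd a) = iso_verts h y"
      using arc[OF a(1)] by simp_all
    moreover have "fst a \<in> pverts G" "snd a \<in> pverts G"
      using a(1) assms(1) by auto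
    ultimately have "fst a = x" "snd a = y"
      using xy inj by (simp_all add: inj_on_eq_iff)
    then show "(x, y) \<in> parcs G" using a(1) by auto
  qed
  then show "\<exists>f. bij_betw f (pverts G) (pverts H) \<and>
    (\<forall>x\<in>pverts G. \<forall>y\<in>pverts G. (x, y) \<in> parcs G \<longleftrightarrow> (f x, f y) \<in> parcs H)"
    using inj V by (auto simp: bij_betw_def)
next
  assume "\<exists>f. bij_betw f (pverts G) (pverts H) \<and>
    (\<forall>x\<in>pverts G. \<forall>y\<in>pverts G. (x, y) \<in> parcs G \<longleftrightarrow> (f x, f y) \<in> parcs H)"
  then obtain f where inj: "inj_on f (pverts G)" and im: "f ` pverts G = pverts H"
    and e: "\<And>x y. x \<in> pverts G \<Longrightarrow> y \<in> pverts G \<Longrightarrow> (x, y) \<in> parcs G \<longleftrightarrow> (f x, f y) \<in> parcs H"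
    by (auto simp: bij_betw_def)
  define h where "h = \<lparr>iso_verts = f, iso_arcs = map_prod f f, iso_head = snd, iso_tail = fst\<rparr>"
  have "wf_digraph (with_proj G)"
    using assms(1) by unfold_locales auto
  moreover have "inj_on (map_prod f f) (parcs G)"
    using inj_on_subset[OF map_prod_inj_on[OF inj inj] assms(1)] .
  ultimately have 1: "pre_digraph.digraph_isomorphism (with_proj G) h"
    using inj by (simp add: pre_digraph.digraph_isomorphism_def h_def)
  have "parcs H = map_prod f f ` parcs G"
  proof
    show "parcs H \<subseteq> map_prod f f ` parcs G"
    proof
      fix p assume p: "p \<in> parcs H"
      then have "fst p \<in> f ` pverts G" "snd p \<in> f ` pverts G" using assms(2) im by auto
      then obtain x y where "x \<in> pverts G" "y \<in> pverts G" "p = (f x, f y)"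
        by (metis imageE prod.collapse)
      then show "p \<in> map_prod f f ` parcs G" using e p by force
    qed
    show "map_prod f f ` parcs G \<subseteq> parcs H" using e assms(1) by fastforce
  qed
  then have "with_proj H = app_iso h (with_proj G)"
    using im by (simp add: with_proj_def app_iso_def h_def)
  then show "graph_iso G H" using 1 unfolding graph_iso_def digraph_iso_def by blast
qed

end

(* In both groups every element is y^i or y^i x, and [y^i x, y^j x] = y^(2(i - j)) while
   [y^i, y^j x] = y^(-2i). Hence [y^i x, _k y^j x] is y^(2^k (i - j)) up to inversion; since y has
   order 2^t m with m odd, it is trivial for some k exactly when m divides i - j. The same
   computation shows that a nilpotent normal subgroup contains no y^i x, so the Fitting subgroup
   is generated by y. That y^i and y^i x are distinct for i modulo the order of y is
   read off an action of words on pairs (exponent, flag). *)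

theory Submission
  imports Defs "HOL-Number_Theory.Cong"
begin

text \<open>Covers the dihedral groups with \<open>c = 0\<close> and the quaternion groups with \<open>2 * c = N\<close>.\<close>

locale dihedral_type = group G for G (structure) +
  fixes x y and N c :: nat
  assumes x_closed [simp]: "x \<in> carrier G" and y_closed [simp]: "y \<in> carrier G"
    and conj_y: "x \<otimes> y \<otimes> inv x = inv y"
    and x_square: "x \<otimes> x = y [^] c"
    and y_pow_eq_one: "\<And>n::nat. y [^] n = \<one> \<longleftrightarrow> N dvd n"
    and x_not_rotation: "\<And>i::int. x \<noteq> y [^] i"
    and carrier_generate: "carrier G = generate G {x, y}"
    and N_dvd: "N dvd 2 * c"
begin

section \<open>Normal forms and their multiplication rules\<close>

text \<open>Exponents are integers so that inverses and the factors (-2)^k in Engel commutators need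
  no truncated subtraction.\<close>

definition rot :: "int \<Rightarrow> 'a" where "rot i = y [^] i"
definition ref :: "int \<Rightarrow> 'a" where "ref i = rot i \<otimes> x"

lemma rot_closed [simp]: "rot i \<in> carrier G"
  by (simp add: rot_def)

lemma ref_closed [simp]: "ref i \<in> carrier G"
  by (simp add: ref_def)

lemma rot_0 [simp]: "rot 0 = \<one>"
  by (simp add: rot_def)

lemma rot_mult: "rot i \<otimes> rot j = rot (i + j)"
  by (simp add: rot_def int_pow_mult)

lemma inv_rot: "inv (rot i) = rot (- i)"
  by (simp add: rot_def int_pow_neg)

lemma rot_eq_one_iff: "rot i = \<one> \<longleftrightarrow> int N dvd i"
proof -
  have pos: "rot i = \<one> \<longleftrightarrow> int N dvd i" if "i \<ge> 0" for i
  proof -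
    have "rot (int (nat i)) = \<one> \<longleftrightarrow> N dvd nat i"
      unfolding rot_def int_pow_int by (rule y_pow_eq_one)
    then show ?thesis using that by (simp add: nat_dvd_iff flip: int_dvd_int_iff)
  qed
  show ?thesis
  proof (cases "i \<ge> 0")
    case False
    \<comment> \<open>The order of y is given through natural powers; a negative exponent is brought
      to them by inversion.\<close>
    have "rot i = \<one> \<longleftrightarrow> rot (- i) = \<one>"
      by (metis inv_rot inv_one add.inverse_inverse)
    then show ?thesis using pos[of "- i"] False by simp
  qed (rule pos)
qed

lemma rot_eq_iff: "rot i = rot j \<longleftrightarrow> int N dvd i - j"
proof -
  have "rot i = rot j \<longleftrightarrow> rot (i - j) = \<one>"
    by (metis diff_conv_add_uminus inv_rot inv_solve_right' l_one one_closed rot_closed rot_mult)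
  then show ?thesis by (simp add: rot_eq_one_iff)
qed

lemma ref_eq_iff: "ref i = ref j \<longleftrightarrow> int N dvd i - j"
  by (simp add: ref_def rot_eq_iff)

lemma rot_neq_ref: "rot i \<noteq> ref j"
proof
  assume "rot i = ref j"
  then have "x = rot (- j + i)"
    by (metis inv_rot inv_solve_left ref_def rot_closed rot_mult x_closed)
  then show False using x_not_rotation by (simp add: rot_def)
qed

text \<open>Conjugation by x inverts y, hence every power of y. Induction covers nonnegative
  exponents, and solving the resulting identity for the other side covers negative ones.\<close>

lemma x_rot: "x \<otimes> rot i = rot (- i) \<otimes> x"
proof -
  have 1: "x \<otimes> y = inv y \<otimes> x"
    by (metis conj_y inv_closed inv_solve_right' m_closed x_closed y_closed)
  have nat: "x \<otimes> rot (int n) = rot (- int n) \<otimes> x" for n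
  proof (induction n)
    case (Suc n)
    have "x \<otimes> rot (int (Suc n)) = x \<otimes> rot (int n) \<otimes> y"
      using rot_mult[of "int n" 1] by (simp add: m_assoc rot_def add.commute)
    also have "\<dots> = rot (- int n) \<otimes> (x \<otimes> y)"
      by (simp add: Suc m_assoc)
    also have "\<dots> = rot (- int n) \<otimes> rot (- 1) \<otimes> x"
      unfolding 1 by (simp add: m_assoc rot_def int_pow_neg)
    finally show ?case by (simp add: rot_mult algebra_simps)
  qed simp
  show ?thesis
  proof (cases i)
    case (nonneg n)
    then show ?thesis using nat by simp
  next
    case (neg n)
    \<comment> \<open>With k = \<open>Suc n\<close>, the nonnegative case turns the right side into
      x y^k y^(-k).\<close>
    have "x = rot (- int (Suc n)) \<otimes> x \<otimes> rot (- int (Suc n))"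
      unfolding nat[symmetric] by (simp add: m_assoc rot_mult)
    then have "rot (int (Suc n)) \<otimes> x = rot (int (Suc n)) \<otimes> (rot (- int (Suc n)) \<otimes> (x \<otimes> rot (- int (Suc n))))"
      by (simp add: m_assoc)
    also have "\<dots> = x \<otimes> rot (- int (Suc n))"
      by (simp add: rot_mult flip: m_assoc)
    finally show ?thesis unfolding neg by (simp only: minus_minus)
  qed
qed

lemma rot_ref: "rot i \<otimes> ref j = ref (i + j)"
  by (simp add: ref_def rot_mult flip: m_assoc)

lemma ref_rot: "ref i \<otimes> rot j = ref (i - j)"
proof -
  have "ref i \<otimes> rot j = rot i \<otimes> (x \<otimes> rot j)"
    by (simp add: ref_def m_assoc)
  also have "\<dots> = rot i \<otimes> rot (- j) \<otimes> x"
    by (simp add: x_rot m_assoc)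
  finally show ?thesis by (simp add: ref_def rot_mult)
qed

lemma ref_ref: "ref i \<otimes> ref j = rot (i - j + int c)"
proof -
  have "ref i \<otimes> ref j = ref i \<otimes> rot j \<otimes> x"
    by (simp add: ref_def m_assoc)
  also have "\<dots> = rot (i - j) \<otimes> (x \<otimes> x)"
    unfolding ref_rot by (simp add: ref_def m_assoc)
  also have "x \<otimes> x = rot (int c)"
    by (simp add: x_square rot_def int_pow_int)
  finally show ?thesis by (simp add: rot_mult)
qed

lemma N_dvd_int: "int N dvd 2 * int c"
  using N_dvd unfolding int_dvd_int_iff[symmetric] by simp

text \<open>The product of the two is y^(2c), which is trivial because N divides 2c; hence +c serves
  as well as -c.\<close>

lemma inv_ref: "inv (ref i) = ref (i + int c)"
proof (rule inv_equality)
  show "ref (i + int c) \<otimes> ref i = \<one>"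
    using N_dvd_int by (simp add: ref_ref rot_eq_one_iff)
qed simp_all

lemma carrier_eq: "carrier G = range rot \<union> range ref"
proof -
  have "subgroup (range rot \<union> range ref) G"
    by unfold_locales
      (auto simp: rot_mult rot_ref ref_rot ref_ref inv_rot inv_ref simp flip: rot_0)
  moreover have "x = ref 0" "y = rot 1"
    by (simp_all add: ref_def) (simp add: rot_def)
  then have "{x, y} \<subseteq> range rot \<union> range ref" by blast
  ultimately have "carrier G \<subseteq> range rot \<union> range ref"
    unfolding carrier_generate by (simp only: generate_subgroup_incl)
  then show ?thesis by auto
qed

section \<open>Commutators and Engel commutators\<close>

text \<open>Absorbs the 2c that the commutator computations leave in the exponent.\<close>

lemma rot_add_2c: "rot (i + 2 * int c) = rot i"
  using N_dvd_int by (simp add: rot_eq_iff)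

lemma commutator_rot_ref: "commutator G (rot i) (ref j) = rot (- 2 * i)"
  using rot_add_2c[of "- 2 * i"]
  by (simp add: commutator_def inv_rot inv_ref rot_ref ref_rot ref_ref algebra_simps)

lemma commutator_ref_ref: "commutator G (ref i) (ref j) = rot (2 * (i - j))"
  using rot_add_2c[of "2 * (i - j)"]
  by (simp add: commutator_def inv_ref rot_ref ref_rot ref_ref algebra_simps)

lemma engel_commutator_rot_ref: "engel_commutator G k (rot i) (ref j) = rot ((- 2) ^ k * i)"
  by (induction k) (simp_all add: commutator_rot_ref mult.assoc)

text \<open>The first commutator is already a power of y, and each of the remaining k steps
  multiplies its exponent by -2; hence the start at \<open>Suc k\<close>.\<close>

lemma engel_commutator_ref_ref:
  "engel_commutator G (Suc k) (ref i) (ref j) = rot ((- 2) ^ k * (2 * (i - j)))"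
proof (induction k)
  case (Suc k)
  show ?case unfolding engel_commutator.simps(2)[of G "Suc k"] Suc
    by (simp add: commutator_rot_ref mult.assoc)
qed (simp add: commutator_ref_ref)

section \<open>The Fitting subgroup\<close>

lemma normal_rotations: "range rot \<lhd> G"
  unfolding normal_inv_iff
proof (intro conjI ballI)
  show "subgroup (range rot) G"
    by unfold_locales (auto simp: rot_mult inv_rot intro: rangeI[of rot 0] simp flip: rot_0)
next
  fix g h assume "g \<in> carrier G" "h \<in> range rot"
  then show "g \<otimes> h \<otimes> inv g \<in> range rot"
    by (auto simp: carrier_eq inv_rot inv_ref rot_mult ref_rot ref_ref)
qed

text \<open>Powers of y commute, so the lower central series reaches the identity after one
  step.\<close>

lemma nilpotent_rotations: "nilpotent_group (G\<lparr>carrier := range rot\<rparr>)"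
proof -
  let ?H = "G\<lparr>carrier := range rot\<rparr>"
  have sub: "subgroup (range rot) G"
    using normal_rotations by (simp add: normal_inv_iff)
  then interpret H: group ?H
    by (rule subgroup_imp_group)
  have comm: "commutator ?H u v = \<one>" if "u \<in> range rot" "v \<in> range rot" for u v
    using that by (auto simp: commutator_def m_inv_consistent[OF sub] inv_rot rot_mult)
  have "{commutator ?H u v | u v. u \<in> range rot \<and> v \<in> range rot} = {\<one>}" (is "?C = _")
  proof
    show "?C \<subseteq> {\<one>}" using comm by blast
    \<comment> \<open>The set of commutators is nonempty, so it is exactly the singleton to which
      \<open>generate_one\<close> applies.\<close>
    have "\<one> = commutator ?H (rot 0) (rot 0)" by (rule comm[symmetric]) blast+
    then show "{\<one>} \<subseteq> ?C" by blast
  qed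
  then have "lower_central ?H 1 = {\<one>\<^bsub>?H\<^esub>}"
    using H.generate_one by simp
  then show ?thesis
    unfolding nilpotent_group_def using H.is_group by blast
qed

text \<open>An element y^i x of H forces y^2 into H, and repeated commutators with it put y^((-2)^k
  * 2) into the k-th term of the lower central series. None of these is trivial, since N has the odd
  divisor m > 1.\<close>

lemma normal_nilpotent_subset_rotations:
  assumes "H \<lhd> G" "nilpotent_group (G\<lparr>carrier := H\<rparr>)"
    and "odd m" "m > 1" "m dvd N"
  shows "H \<subseteq> range rot"
proof (rule ccontr)
  assume "\<not> H \<subseteq> range rot"
  have sub: "subgroup H G" and conj: "\<And>g h. g \<in> carrier G \<Longrightarrow> h \<in> H \<Longrightarrow> g \<otimes> h \<otimes> inv g \<in> H"
    using assms(1) by (auto simp: normal_inv_iff)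
  let ?H = "G\<lparr>carrier := H\<rparr>"
  have "H \<subseteq> range rot \<union> range ref"
    using subgroup.subset[OF sub] carrier_eq by simp
  then obtain i where i: "ref i \<in> H"
    using \<open>\<not> H \<subseteq> range rot\<close> by blast
  \<comment> \<open>By normality H contains the conjugate of \<open>ref i\<close> by y; dividing by
    \<open>ref i\<close> leaves y^2.\<close>
  have "rot 1 \<otimes> ref i \<otimes> inv (rot 1) \<otimes> inv (ref i) \<in> H"
    using i conj by (simp add: subgroup.m_closed[OF sub] subgroup.m_inv_closed[OF sub])
  then have 2: "rot 2 \<in> H"
    using rot_add_2c[of 2]
    by (simp add: inv_rot inv_ref rot_ref ref_rot ref_ref subgroup.m_closed[OF sub] )
  \<comment> \<open>Membership in H is carried along because \<open>m_inv_consistent\<close>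
    identifies the inverses of \<open>?H\<close> and G for elements of H. As
    \<open>lower_central ?H 0\<close> is H, y^2 starts the induction.\<close>
  have mem: "rot ((- 2) ^ k * 2) \<in> lower_central ?H k \<inter> H" for k
  proof (induction k)
    case (Suc k)
    have eq: "commutator ?H (rot ((- 2) ^ k * 2)) (ref i) = rot ((- 2) ^ Suc k * 2)"
      using Suc i commutator_rot_ref[of "(- 2) ^ k * 2" i]
      by (simp add: commutator_def m_inv_consistent[OF sub])
    then have "rot ((- 2) ^ Suc k * 2) \<in> lower_central ?H (Suc k)"
      unfolding lower_central.simps using Suc i
      by (intro generate.incl CollectI exI[of _ "rot ((- 2) ^ k * 2)"] exI[of _ "ref i"]) simp_all
    moreover have "rot ((- 2) ^ Suc k * 2) \<in> H"
      using eq[symmetric] Suc i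
      by (simp add: commutator_def m_inv_consistent[OF sub] subgroup.m_closed[OF sub] subgroup.m_inv_closed[OF sub])
    ultimately show ?case by blast
  qed (use 2 in simp)
  obtain k where "lower_central ?H k = {\<one>}"
    using assms(2) by (auto simp: nilpotent_group_def)
  then have "int N dvd (- 2) ^ k * 2"
    using mem[of k] by (simp add: rot_eq_one_iff)
  then have "int m dvd (- 2) ^ k * 2"
    using assms(5) by (meson dvd_trans int_dvd_int_iff)
  \<comment> \<open>An odd m dividing a power of 2 up to sign is a unit, against m > 1.\<close>
  moreover have "coprime (int m) ((- 2) ^ k * 2)"
    using assms(3) by simp
  ultimately show False
    using assms(4) by (simp only: coprime_absorb_left) simp
qed

lemma fitting_subgroup_eq:
  assumes "odd m" "m > 1" "m dvd N"
  shows "fitting_subgroup G = range rot"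
proof
  let ?U = "\<Union>{H. H \<lhd> G \<and> nilpotent_group (G\<lparr>carrier := H\<rparr>)}"
  show "range rot \<subseteq> fitting_subgroup G"
    unfolding fitting_subgroup_def using normal_rotations nilpotent_rotations
    by (blast intro: generate.incl)
  have "?U \<subseteq> range rot"
    using normal_nilpotent_subset_rotations assms by blast
  then show "fitting_subgroup G \<subseteq> range rot"
    unfolding fitting_subgroup_def
    using generate_subgroup_incl normal_rotations by (simp add: normal_inv_iff)
qed

section \<open>Adjacency and the graph isomorphisms\<close>

lemma engel_ref_ref_iff:
  assumes "odd m" and N: "N = 2 ^ t * m"
  shows "(\<forall>k\<ge>1. engel_commutator G k (ref i) (ref j) \<noteq> \<one>) \<longleftrightarrow> \<not> [i = j] (mod int m)"
proof -
  have *: "engel_commutator G (Suc k) (ref i) (ref j) = \<one> \<longleftrightarrow> int N dvd 2 ^ Suc k * (i - j)" for k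
  proof -
    have "(- 2) ^ k * (2 * (i - j)) = (- 1) ^ k * (2 ^ Suc k * (i - j))"
      by (simp add: power_minus[of 2 k])
    then show ?thesis
      unfolding engel_commutator_ref_ref rot_eq_one_iff 
      by (cases "even k") (simp_all only: minus_one_power_iff if_True if_False mult_1 mult_minus_left dvd_minus_iff)
  qed
  have "[i = j] (mod int m) \<longleftrightarrow> (\<exists>k. int N dvd 2 ^ Suc k * (i - j))"
  proof
    assume "[i = j] (mod int m)"
    \<comment> \<open>The witness is k = t: 2^t supplies the even part of N, and the extra 2 is the
      one from the first commutator.\<close>
    then have "int N dvd 2 ^ t * (i - j)"
      by (simp add: N cong_iff_dvd_diff)
    then have "int N dvd 2 ^ Suc t * (i - j)"
      by (simp add: mult.assoc)
    then show "\<exists>k. int N dvd 2 ^ Suc k * (i - j)" ..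
  next
    assume "\<exists>k. int N dvd 2 ^ Suc k * (i - j)"
    then obtain k where "int N dvd 2 ^ Suc k * (i - j)" ..
    moreover have "int m dvd int N"
      by (simp add: N)
    ultimately have "int m dvd 2 ^ Suc k * (i - j)"
      by (rule dvd_trans[rotated])
    moreover have "coprime (int m) (2 ^ Suc k)"
      using assms(1) by simp
    ultimately show "[i = j] (mod int m)"
      unfolding cong_iff_dvd_diff by (simp only: coprime_dvd_mult_right_iff)
  qed
  \<comment> \<open>Shifts the range k \<ge> 1 to \<open>Suc k\<close>, the form in which the
    commutators were computed.\<close>
  moreover have "(\<forall>k\<ge>1. P k) \<longleftrightarrow> (\<forall>k. P (Suc k))" for P :: "nat \<Rightarrow> bool"
    by (metis One_nat_def Suc_le_D Suc_le_mono zero_le)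
  ultimately show ?thesis
    by (simp only: * not_ex)
qed

text \<open>The vertices are the y^i x, the complement of the Fitting subgroup, and f reads off the
  exponent i below N. These coordinates serve both the multipartite and the complete graph.\<close>

lemma engel_graph_coordinates:
  assumes "odd m" "m > 1" and N: "N = 2 ^ t * m"
  obtains f where "bij_betw f (pverts (engel_graph G)) {..<N}"
    and "\<And>u v. u \<in> pverts (engel_graph G) \<Longrightarrow> v \<in> pverts (engel_graph G) \<Longrightarrow>
      (u, v) \<in> parcs (engel_graph G) \<longleftrightarrow> \<not> [f u = f v] (mod m)"
proof -
  have "N > 0" using assms by simp
  have V: "pverts (engel_graph G) = range ref"
    using fitting_subgroup_eq[of m] assms rot_neq_ref rot_neq_ref[THEN not_sym]
    by (auto simp: engel_graph_def carrier_eq)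
  have range: "range ref = (\<lambda>n. ref (int n)) ` {..<N}"
  proof -
    have "ref i = ref (int (nat (i mod int N)))" for i
      using \<open>N > 0\<close> by (simp add: ref_eq_iff flip: mod_eq_dvd_iff)
    moreover have "nat (i mod int N) < N" for i
      using \<open>N > 0\<close> by (simp add: nat_less_iff)
    ultimately show ?thesis by blast
  qed
  have "inj_on (\<lambda>n. ref (int n)) {..<N}"
    by (rule inj_onI) (metis ref_eq_iff lessThan_iff mod_eq_dvd_iff mod_less of_nat_eq_iff zmod_int)
  then have b: "bij_betw (\<lambda>n. ref (int n)) {..<N} (pverts (engel_graph G))"
    by (simp add: bij_betw_def V range)
  let ?f = "the_inv_into {..<N} (\<lambda>n. ref (int n))"
  have fr: "ref (int (?f u)) = u" if "u \<in> pverts (engel_graph G)" for u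
    using f_the_inv_into_f_bij_betw[OF b] that by blast
  show ?thesis
  proof (rule that[of ?f])
    show "bij_betw ?f (pverts (engel_graph G)) {..<N}"
      using b by (rule bij_betw_the_inv_into)
    fix u v assume uv: "u \<in> pverts (engel_graph G)" "v \<in> pverts (engel_graph G)"
    then have "(u, v) \<in> parcs (engel_graph G) \<longleftrightarrow>
        u \<noteq> v \<and> (\<forall>k\<ge>1. engel_commutator G k u v \<noteq> \<one>) \<and> (\<forall>k\<ge>1. engel_commutator G k v u \<noteq> \<one>)"
      by (auto simp: engel_graph_def)
    also have "\<dots> \<longleftrightarrow> u \<noteq> v \<and> \<not> [int (?f u) = int (?f v)] (mod int m)"
      using engel_ref_ref_iff[OF assms(1) N, of "int (?f u)" "int (?f v)"]
        engel_ref_ref_iff[OF assms(1) N, of "int (?f v)" "int (?f u)"]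
      by (auto simp: fr uv cong_sym_eq)
    \<comment> \<open>\<open>u \<noteq> v\<close> is absorbed, since equal vertices have equal
      coordinates.\<close>
    also have "\<dots> \<longleftrightarrow> \<not> [?f u = ?f v] (mod m)"
      by (auto simp: cong_int_iff)
    finally show "(u, v) \<in> parcs (engel_graph G) \<longleftrightarrow> \<not> [?f u = ?f v] (mod m)" .
  qed
qed

lemma engel_graph_wf: "parcs (engel_graph G) \<subseteq> pverts (engel_graph G) \<times> pverts (engel_graph G)"
  by (auto simp: engel_graph_def)

text \<open>The residue of the exponent modulo m names the part, and the quotient by m, which is
  below 2^t, the place inside it.\<close>

lemma engel_graph_iso_multipartite:
  assumes "odd m" "m > 1" "N = 2 ^ t * m"
  shows "graph_iso (engel_graph G) (complete_multipartite_graph m (2 ^ t))"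
proof -
  obtain f where f: "bij_betw f (pverts (engel_graph G)) {..<N}"
    and arc: "\<And>u v. u \<in> pverts (engel_graph G) \<Longrightarrow> v \<in> pverts (engel_graph G) \<Longrightarrow>
      (u, v) \<in> parcs (engel_graph G) \<longleftrightarrow> \<not> [f u = f v] (mod m)"
    using engel_graph_coordinates[OF assms] by metis
  have g: "bij_betw (\<lambda>n. (n mod m, n div m)) {..<N} ({..<m} \<times> {..<2 ^ t})"
  proof (rule bij_betw_byWitness[where f' = "\<lambda>(a, b). a + b * m"])
    show "(\<lambda>(a, b). a + b * m) ` ({..<m} \<times> {..<2 ^ t}) \<subseteq> {..<N}"
    proof clarsimp
      fix a b assume "a < m" "b < (2::nat) ^ t"
      then have "a + b * m < (b + 1) * m" "(b + 1) * m \<le> 2 ^ t * m"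
        by (simp, intro mult_le_mono1, simp)
      then show "a + b * m < N" unfolding assms(3) by linarith
    qed
  qed (use assms in \<open>auto simp: less_mult_imp_div_less\<close>)
  have "bij_betw ((\<lambda>n. (n mod m, n div m)) \<circ> f) (pverts (engel_graph G))
      (pverts (complete_multipartite_graph m (2 ^ t)))"
    using bij_betw_trans[OF f g] by (simp add: complete_multipartite_graph_def)
  moreover have "(u, v) \<in> parcs (engel_graph G) \<longleftrightarrow>
      (((\<lambda>n. (n mod m, n div m)) \<circ> f) u, ((\<lambda>n. (n mod m, n div m)) \<circ> f) v)
        \<in> parcs (complete_multipartite_graph m (2 ^ t))"
    if uv: "u \<in> pverts (engel_graph G)" "v \<in> pverts (engel_graph G)" for u v
  proof -
    have "f u < 2 ^ t * m" "f v < 2 ^ t * m"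
      using f uv assms(3) by (auto simp: bij_betw_def)
    then show ?thesis using assms(2)
      by (simp add: arc[OF uv] complete_multipartite_graph_def less_mult_imp_div_less cong_def)
  qed
  ultimately show ?thesis
    by (subst graph_iso_iff[OF engel_graph_wf]) (auto simp: complete_multipartite_graph_def)
qed

text \<open>The case t = 0: for numbers below m, incongruent modulo m means distinct.\<close>

lemma engel_graph_iso_complete:
  assumes "odd m" "m > 1" "N = m"
  shows "graph_iso (engel_graph G) (complete_graph m)"
proof -
  obtain f where f: "bij_betw f (pverts (engel_graph G)) {..<m}"
    and arc: "\<And>u v. u \<in> pverts (engel_graph G) \<Longrightarrow> v \<in> pverts (engel_graph G) \<Longrightarrow>
      (u, v) \<in> parcs (engel_graph G) \<longleftrightarrow> \<not> [f u = f v] (mod m)"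
    using engel_graph_coordinates[of m 0] assms by auto
  have "(u, v) \<in> parcs (engel_graph G) \<longleftrightarrow> (f u, f v) \<in> parcs (complete_graph m)"
    if uv: "u \<in> pverts (engel_graph G)" "v \<in> pverts (engel_graph G)" for u v
  proof -
    have "f u < m" "f v < m"
      using f uv by (auto simp: bij_betw_def)
    then show ?thesis by (simp add: arc[OF uv] complete_graph_def cong_def)
  qed
  then show ?thesis
    using f by (subst graph_iso_iff[OF engel_graph_wf]) (auto simp: complete_graph_def)
qed

end

section \<open>Presented groups through an action of words\<close>

text \<open>One presentation for both families: for \<open>c = 0\<close> the second relation has the
  empty word on the right and gives x^2 = 1.\<close>

definition dihedral_type_rels :: "nat \<Rightarrow> nat \<Rightarrow> (gen word \<times> gen word) set" where
  "dihedral_type_rels N c =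
    {(replicate N (gen_y, True), []),
     (replicate 2 (gen_x, True), replicate c (gen_y, True)),
     ([(gen_x, True), (gen_y, True), (gen_x, False)], [(gen_y, False)])}"

text \<open>Left multiplication by a letter, with \<open>(i, s)\<close> standing for \<open>y\<^sup>i\<close> or, if \<open>s\<close> holds, for
  \<open>y\<^sup>i x\<close>. The exponents are integers rather than residues, so that a letter and its
  inverse cancel exactly; the relations hold only modulo \<open>N\<close>.\<close>

fun letter_action :: "nat \<Rightarrow> gen \<times> bool \<Rightarrow> int \<times> bool \<Rightarrow> int \<times> bool" where
  "letter_action c (gen_y, b) (i, s) = (if b then i + 1 else i - 1, s)"
| "letter_action c (gen_x, b) (i, s) = (if s = b then int c - i else - i, \<not> s)"

text \<open>Each letter changes the exponent by a shift, a negation or both, which respects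
  residues.\<close>

lemma letter_action_cong:
  assumes "[i = j] (mod int N)"
  shows "snd (letter_action c l (i, s)) = snd (letter_action c l (j, s)) \<and>
    [fst (letter_action c l (i, s)) = fst (letter_action c l (j, s))] (mod int N)"
proof -
  have "[i + 1 = j + 1] (mod int N)" "[i - 1 = j - 1] (mod int N)"
    "[- i = - j] (mod int N)" "[int c - i = int c - j] (mod int N)"
    using assms cong_diff[OF cong_refl assms]
    by (simp_all only: cong_minus_minus_iff cong_add_rcancel cong_diff cong_refl)
  moreover obtain a b where "l = (a, b)" by fastforce
  ultimately show ?thesis by (cases a) simp_all
qed

lemma word_action_cong:
  assumes "snd p = snd q" "[fst p = fst q] (mod int N)"
  shows "snd (foldr (letter_action c) w p) = snd (foldr (letter_action c) w q) \<and>
    [fst (foldr (letter_action c) w p) = fst (foldr (letter_action c) w q)] (mod int N)"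
  using assms
proof (induction w)
  case (Cons l w)
  obtain i s where p: "foldr (letter_action c) w p = (i, s)" by fastforce
  obtain j s' where q: "foldr (letter_action c) w q = (j, s')" by fastforce
  have "s = s'" "[i = j] (mod int N)"
    using Cons by (simp_all add: p q)
  then show ?case
    using letter_action_cong[of i j N c l s] by (simp add: p q)
qed simp

lemma word_action_rotation:
  "(letter_action c (gen_y, True) ^^ n) (i, s) = (i + int n, s)"
  by (induction n) auto

text \<open>The action satisfies the relations modulo N, so it can show that two words represent
  different group elements.\<close>

lemma word_action_pres_rel:
  assumes "(u, v) \<in> pres_rel (dihedral_type_rels N c)" "N dvd 2 * c"
  shows "snd (foldr (letter_action c) u p) = snd (foldr (letter_action c) v p) \<and>
    [fst (foldr (letter_action c) u p) = fst (foldr (letter_action c) v p)] (mod int N)"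
  using assms(1)
proof (induction arbitrary: p)
  case (cancel u a b v)
  \<comment> \<open>Cancellation is exact: for x both letters apply the same involution to the
    exponent, i to c - i if the flag of q differs from b and i to -i otherwise.\<close>
  have "foldr (letter_action c) [(a, b), (a, \<not> b)] q = q" for q
    by (cases a; cases q) auto
  then show ?case by simp
next
  case (rel r s u v)
  \<comment> \<open>The word x x adds c to the exponent of an unflagged pair but subtracts c for a
    flagged one; the latter matches y^c because 2c is 0 modulo N.\<close>
  have c: "[int c + int c = 0] (mod int N)"
    using assms(2) by (simp add: cong_0_iff flip: int_dvd_int_iff)
  have "snd (foldr (letter_action c) r q) = snd (foldr (letter_action c) s q) \<and>
    [fst (foldr (letter_action c) r q) = fst (foldr (letter_action c) s q)] (mod int N)" for q
    using rel c unfolding dihedral_type_rels_def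
    by (cases q) (auto simp: word_action_rotation numeral_2_eq_2 cong_iff_dvd_diff algebra_simps)
  \<comment> \<open>The suffix v only changes the starting pair, which is arbitrary; the prefix u
    preserves agreement modulo N.\<close>
  then show ?case
    unfolding foldr_append comp_apply by (intro word_action_cong) simp_all
next
  case (sym u v)
  then show ?case by (simp add: cong_sym_eq)
next
  case (trans u v w)
  then show ?case by (metis cong_trans)
qed simp

text \<open>The equations come from the relations. That y has no smaller order and that x is not a
  power of y is seen from the action on \<open>(0, False)\<close>.\<close>

lemma dihedral_type_presented_group:
  assumes "N dvd 2 * c" "N > 0"
  defines "R \<equiv> dihedral_type_rels N c"
  shows "dihedral_type (presented_group R) (pres_rel R `` {[(gen_x, True)]})
    (pres_rel R `` {[(gen_y, True)]}) N c"
proof -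
  let ?G = "presented_group R"
  define cl where "cl w = pres_rel R `` {w}" for w
  define x where "x = cl [(gen_x, True)]"
  define y where "y = cl [(gen_y, True)]"
  interpret group ?G by (rule group_presented_group)
  have cl_mult: "cl u \<otimes>\<^bsub>?G\<^esub> cl v = cl (u @ v)" for u v
    by (simp add: cl_def presented_group_mult)
  have cl_one: "\<one>\<^bsub>?G\<^esub> = cl []"
    by (simp add: cl_def presented_group_def)
  have cl_closed [simp]: "cl u \<in> carrier ?G" for u
    by (simp add: cl_def presented_group_def quotientI)
  have cl_eq_iff: "cl u = cl v \<longleftrightarrow> (u, v) \<in> pres_rel R" for u v
    unfolding cl_def by (simp add: eq_equiv_class_iff[OF equiv_pres_rel])
  have cl_rel: "cl u = cl v" if "(u, v) \<in> R" for u v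
    using pres_rel.rel[OF that, of "[]" "[]"] by (simp add: cl_eq_iff)
  have cl_inv: "inv\<^bsub>?G\<^esub> cl [(a, True)] = cl [(a, False)]" for a
    using pres_rel.cancel[of "[]" a False "[]" R]
    by (intro inv_equality) (simp_all add: cl_mult cl_one cl_eq_iff)
  have [simp]: "x \<in> carrier ?G" "y \<in> carrier ?G"
    by (simp_all add: x_def y_def)
  have y_pow: "y [^]\<^bsub>?G\<^esub> n = cl (replicate n (gen_y, True))" for n :: nat
    by (induction n) (simp_all add: cl_one cl_mult y_def replicate_append_same)
  have "dihedral_type ?G x y N c"
  proof
    show "x \<in> carrier ?G" "y \<in> carrier ?G" by simp_all
    show conj: "x \<otimes>\<^bsub>?G\<^esub> y \<otimes>\<^bsub>?G\<^esub> inv\<^bsub>?G\<^esub> x = inv\<^bsub>?G\<^esub> y"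
      unfolding x_def y_def cl_inv cl_mult by (rule cl_rel) (simp add: R_def dihedral_type_rels_def)
    show sq: "x \<otimes>\<^bsub>?G\<^esub> x = y [^]\<^bsub>?G\<^esub> c"
      unfolding x_def cl_mult y_pow by (rule cl_rel) (simp add: R_def dihedral_type_rels_def numeral_2_eq_2)
    have yN: "y [^]\<^bsub>?G\<^esub> N = \<one>\<^bsub>?G\<^esub>"
      unfolding cl_one y_pow by (rule cl_rel) (simp add: R_def dihedral_type_rels_def)
    show "y [^]\<^bsub>?G\<^esub> n = \<one>\<^bsub>?G\<^esub> \<longleftrightarrow> N dvd n" for n :: nat
    proof
      assume "y [^]\<^bsub>?G\<^esub> n = \<one>\<^bsub>?G\<^esub>"
      then have "(replicate n (gen_y, True), []) \<in> pres_rel (dihedral_type_rels N c)"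
        unfolding y_pow cl_one cl_eq_iff unfolding R_def .
      \<comment> \<open>y^n moves the exponent from 0 to n, while the empty word leaves it at
        0.\<close>
      from word_action_pres_rel[OF this assms(1), of "(0, False)"]
      show "N dvd n" by (simp add: word_action_rotation cong_0_iff)
    next
      assume "N dvd n"
      then show "y [^]\<^bsub>?G\<^esub> n = \<one>\<^bsub>?G\<^esub>"
        by (auto simp: yN simp flip: nat_pow_pow)
    qed
    show "x \<noteq> y [^]\<^bsub>?G\<^esub> i" for i :: int
    proof
      assume x: "x = y [^]\<^bsub>?G\<^esub> i"
      \<comment> \<open>The exponent is reduced to a natural number below N, so that the power of y
        is represented by a word without inverse letters.\<close>
      have "y [^]\<^bsub>?G\<^esub> i = y [^]\<^bsub>?G\<^esub> (i mod int N + int N * (i div int N))" by simp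
      also have "\<dots> = y [^]\<^bsub>?G\<^esub> (i mod int N)"
        using yN by (simp only: int_pow_mult \<open>y \<in> carrier ?G\<close>) (simp add: int_pow_int flip: int_pow_pow)
      also have "\<dots> = y [^]\<^bsub>?G\<^esub> nat (i mod int N)"
        using assms(2) by (simp flip: int_pow_int)
      finally have "([(gen_x, True)], replicate (nat (i mod int N)) (gen_y, True))
          \<in> pres_rel (dihedral_type_rels N c)"
        using x unfolding x_def y_pow by (simp add: cl_eq_iff) (simp add: R_def)
      \<comment> \<open>The flags disagree: x sets it, powers of y do not.\<close>
      from word_action_pres_rel[OF this assms(1), of "(0, False)"]
      show False by (simp add: word_action_rotation)
    qed
    show "N dvd 2 * c" by fact
    have "cl w \<in> generate ?G {x, y}" for w
    proof (induction w)
      case Nil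
      show ?case unfolding cl_one[symmetric] by (rule generate.one)
    next
      case (Cons l w)
      obtain a b where l: "l = (a, b)" by fastforce
      have "cl [(a, True)] \<in> {x, y}"
        by (cases a) (simp_all add: x_def y_def)
      then have "cl [l] \<in> generate ?G {x, y}"
        by (cases b) (auto simp: l intro: generate.incl generate.inv simp flip: cl_inv)
      then show ?case
        using generate.eng[OF _ Cons] cl_mult[of "[l]" w] by fastforce
    qed
    moreover have "\<exists>w. g = cl w" if "g \<in> carrier ?G" for g
      using that by (auto simp: presented_group_def cl_def elim!: quotientE)
    ultimately show "carrier ?G = generate ?G {x, y}"
      using generate_incl[of "{x, y}"] by auto
  qed
  then show ?thesis by (simp add: x_def y_def cl_def)
qed

theorem theorem6p1:
  fixes m :: nat
  assumes "m \<ge> 3" and "odd m"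
  shows "(\<forall>t::nat. t \<ge> 1 \<longrightarrow>
            graph_iso (engel_graph (dihedral_group (2 ^ t * m))) (complete_multipartite_graph m (2 ^ t)) \<and>
            graph_iso (engel_graph (quaternion_group t m)) (complete_multipartite_graph m (2 ^ t))) \<and>
         graph_iso (engel_graph (dihedral_group m)) (complete_graph m)"
proof -
  have dihedral: "dihedral_group n = presented_group (dihedral_type_rels n 0)" for n
    by (simp add: dihedral_group_def dihedral_type_rels_def)
  have quaternion: "quaternion_group t m =
      presented_group (dihedral_type_rels (2 ^ t * m) (2 ^ (t - 1) * m))" for t
    by (simp add: quaternion_group_def dihedral_type_rels_def)
  \<comment> \<open>The divisibility required of the quaternion presentation, where N = 2c; the
    dihedral one has c = 0.\<close>
  have "2 ^ t * m dvd 2 * (2 ^ (t - 1) * m)" if "t \<ge> 1" for t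
    using that by (cases t) simp_all
  then show ?thesis
    unfolding dihedral quaternion using assms
    by (auto intro!: dihedral_type.engel_graph_iso_multipartite dihedral_type.engel_graph_iso_complete
        dihedral_type_presented_group)
qed

end
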